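(* Let $M$ and $N$ be matroids on disjoint finite sets $S$ and $T$, and let $A\subseteq S$, $B\subseteq T$. For $X\subseteq S$ and $Y\subseteq T$, the set $X\cup Y$ is cyclic in the principal sum $(M,N;A,B)$ if and only if either (1) $X$ is cyclic in $M$, $Y$ is cyclic in $N$, and $Y\cap B=\emptyset$; or (2) the only coloops of $M|(X\cup A)$ are in $A$, $Y$ is cyclic in $N$, and $r_M(X\cup A)+r_N(Y)<r_M(X)+r_N(Y-B)+|Y\cap B|$.
   Context: A set in a matroid is cyclic if it is a (possibly empty) union of circuits. The principal sum $(M,N;A,B)$ is the matroid union $M^+(A,B)\vee N_0$, where: $N_0=N\oplus U_{0,S}$ ($N$ with the elements of $S$ added as loops); $M^+(A,B)$ is the matroid on $S\cup T$ obtained from $M$ by adding each element of $B$ freely (by successive principal extensions) to the flat $\mathrm{cl}_M(A)$ and each element of $T-B$ as a loop, equivalently the matroid with rank function $r(X\cup Y)=\min\{r_M(X\cup A),\,r_M(X)+|Y\cap B|\}$ for $X\subseteq S$, $Y\subseteq T$; and the matroid union $G\vee H$ of matroids on a common set has as independent sets the unions of an independent set of $G$ and an independent set of $H$. *)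

theory Defs
  imports Main
begin

record 'a independence_system =
  ground :: "'a set"
  indeps :: "'a set set"

definition matroid :: "'a independence_system \<Rightarrow> bool" where
  "matroid M \<longleftrightarrow>
     finite (ground M) \<and>
     indeps M \<subseteq> Pow (ground M) \<and>
     {} \<in> indeps M \<and>
     (\<forall>I\<in>indeps M. \<forall>J. J \<subseteq> I \<longrightarrow> J \<in> indeps M) \<and>
     (\<forall>I\<in>indeps M. \<forall>J\<in>indeps M. card I < card J \<longrightarrow> (\<exists>x\<in>J - I. insert x I \<in> indeps M))"

definition rk :: "'a independence_system \<Rightarrow> 'a set \<Rightarrow> nat" where
  "rk M X = Max (card ` {I \<in> indeps M. I \<subseteq> X})"

definition circuit :: "'a independence_system \<Rightarrow> 'a set \<Rightarrow> bool" where
  "circuit M C \<longleftrightarrow> C \<subseteq> ground M \<and> C \<notin> indeps M \<and> (\<forall>D. D \<subset> C \<longrightarrow> D \<in> indeps M)"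

definition cyclic :: "'a independence_system \<Rightarrow> 'a set \<Rightarrow> bool" where
  "cyclic M X \<longleftrightarrow> (\<exists>\<C>. (\<forall>C\<in>\<C>. circuit M C) \<and> X = \<Union>\<C>)"

definition basis :: "'a independence_system \<Rightarrow> 'a set \<Rightarrow> bool" where
  "basis M I \<longleftrightarrow> I \<in> indeps M \<and> (\<forall>J\<in>indeps M. I \<subseteq> J \<longrightarrow> J = I)"

definition coloop :: "'a independence_system \<Rightarrow> 'a \<Rightarrow> bool" where
  "coloop M e \<longleftrightarrow> e \<in> ground M \<and> (\<forall>I. basis M I \<longrightarrow> e \<in> I)"

definition restriction :: "'a independence_system \<Rightarrow> 'a set \<Rightarrow> 'a independence_system" where
  "restriction M X = \<lparr>ground = ground M \<inter> X, indeps = {I \<in> indeps M. I \<subseteq> X}\<rparr>"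

definition uniform :: "nat \<Rightarrow> 'a set \<Rightarrow> 'a independence_system" where
  "uniform k E = \<lparr>ground = E, indeps = {I. I \<subseteq> E \<and> finite I \<and> card I \<le> k}\<rparr>"

text \<open>The ground sets are meant to be disjoint in \<open>direct_sum\<close> and equal in \<open>matroid_union\<close>;
  the two constructions are then given by the same formula.\<close>

definition direct_sum ::
  "'a independence_system \<Rightarrow> 'a independence_system \<Rightarrow> 'a independence_system" where
  "direct_sum G H =
     \<lparr>ground = ground G \<union> ground H,
      indeps = {I \<union> J | I J. I \<in> indeps G \<and> J \<in> indeps H}\<rparr>"

definition matroid_union ::
  "'a independence_system \<Rightarrow> 'a independence_system \<Rightarrow> 'a independence_system" where
  "matroid_union G H =
     \<lparr>ground = ground G \<union> ground H,
      indeps = {I \<union> J | I J. I \<in> indeps G \<and> J \<in> indeps H}\<rparr>"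

text \<open>The rank function of the extension \<open>M\<^sup>+(A,B)\<close> of \<open>M\<close> by the set \<open>T\<close>, where every element of
  \<open>B\<close> is added freely to the closure of \<open>A\<close> and every element of \<open>T - B\<close> is added as a loop.
  The argument \<open>Z\<close> is split as \<open>X \<union> Y\<close> with \<open>X \<subseteq> ground M\<close> and \<open>Y \<subseteq> T\<close>.\<close>

definition free_ext_rk ::
  "'a independence_system \<Rightarrow> 'a set \<Rightarrow> 'a set \<Rightarrow> 'a set \<Rightarrow> 'a set \<Rightarrow> nat" where
  "free_ext_rk M A B T Z =
     (let X = Z \<inter> ground M; Y = Z \<inter> T
      in min (rk M (X \<union> A)) (rk M X + card (Y \<inter> B)))"

text \<open>The matroid with this rank function: a set is independent iff its rank is its cardinality.
  That this is a matroid with rank function \<open>free_ext_rk\<close> is checked in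
  \<open>matroid_free_ext\<close> and \<open>rk_free_ext\<close> below.\<close>

definition free_ext ::
  "'a independence_system \<Rightarrow> 'a set \<Rightarrow> 'a set \<Rightarrow> 'a set \<Rightarrow> 'a independence_system" where
  "free_ext M A B T =
     \<lparr>ground = ground M \<union> T,
      indeps = {I. I \<subseteq> ground M \<union> T \<and> free_ext_rk M A B T I = card I}\<rparr>"

definition principal_sum ::
  "'a independence_system \<Rightarrow> 'a independence_system \<Rightarrow> 'a set \<Rightarrow> 'a set \<Rightarrow> 'a independence_system"
  where
  "principal_sum M N A B =
     matroid_union (free_ext M A B (ground N)) (direct_sum N (uniform 0 (ground M)))"

context
  fixes M :: "'a independence_system"
  assumes M: "matroid M"
begin

lemma indep_finite: "I \<in> indeps M \<Longrightarrow> finite I"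
  using M finite_subset[of I "ground M"] unfolding matroid_def by auto

lemma finite_indeps: "finite {I \<in> indeps M. I \<subseteq> X}"
  using M finite_subset[of "{I \<in> indeps M. I \<subseteq> X}" "Pow (ground M)"]
  unfolding matroid_def by auto

lemma indep_subset: "I \<in> indeps M \<Longrightarrow> J \<subseteq> I \<Longrightarrow> J \<in> indeps M"
  using M unfolding matroid_def by blast

lemma augment:
  "I \<in> indeps M \<Longrightarrow> J \<in> indeps M \<Longrightarrow> card I < card J \<Longrightarrow> \<exists>x\<in>J - I. insert x I \<in> indeps M"
  using M unfolding matroid_def by blast

lemma card_le_rk: "I \<in> indeps M \<Longrightarrow> I \<subseteq> X \<Longrightarrow> card I \<le> rk M X"
  unfolding rk_def by (rule Max_ge) (use finite_indeps in auto)

lemma rk_witness: "\<exists>I\<in>indeps M. I \<subseteq> X \<and> card I = rk M X"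
proof -
  have "{} \<in> indeps M" using M unfolding matroid_def by blast
  then have "rk M X \<in> card ` {I \<in> indeps M. I \<subseteq> X}"
    unfolding rk_def by (intro Max_in) (use finite_indeps in auto)
  then show ?thesis by auto
qed

lemma rk_mono: "X \<subseteq> Y \<Longrightarrow> rk M X \<le> rk M Y"
proof -
  assume "X \<subseteq> Y"
  obtain I where "I \<in> indeps M" "I \<subseteq> X" "card I = rk M X" using rk_witness by blast
  then show ?thesis using card_le_rk[of I Y] \<open>X \<subseteq> Y\<close> by auto
qed

lemma rk_indep: "I \<in> indeps M \<Longrightarrow> rk M I = card I"
proof -
  assume I: "I \<in> indeps M"
  obtain J where "J \<in> indeps M" "J \<subseteq> I" "card J = rk M I" using rk_witness by blast
  then have "rk M I \<le> card I" using card_mono[OF indep_finite[OF I], of J] by simp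
  then show ?thesis using card_le_rk[OF I, of I] by simp
qed

lemma extend:
  assumes "I \<in> indeps M" "I \<subseteq> X"
  shows "\<exists>J\<in>indeps M. I \<subseteq> J \<and> J \<subseteq> X \<and> card J = rk M X"
  using assms
proof (induction "rk M X - card I" arbitrary: I rule: less_induct)
  case less
  show ?case
  proof (cases "card I = rk M X")
    case False
    then have lt: "card I < rk M X" using card_le_rk less.prems by (simp add: le_neq_implies_less)
    obtain K where K: "K \<in> indeps M" "K \<subseteq> X" "card K = rk M X" using rk_witness by blast
    then obtain x where x: "x \<in> K - I" "insert x I \<in> indeps M"
      using augment[OF less.prems(1)] lt by metis
    have "card (insert x I) = Suc (card I)" using x indep_finite[OF less.prems(1)] by simp
    moreover have "insert x I \<subseteq> X" using x K less.prems by blast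
    ultimately obtain J where "J \<in> indeps M" "insert x I \<subseteq> J" "J \<subseteq> X" "card J = rk M X"
      using less.hyps[OF _ x(2)] lt by (metis diff_less_mono2 lessI)
    then show ?thesis by blast
  qed (use less in blast)
qed

lemma rk_jump:
  assumes "rk M X < rk M (X \<union> Y)"
  shows "\<exists>y\<in>Y. rk M X < rk M (insert y X)"
proof -
  obtain I where I: "I \<in> indeps M" "I \<subseteq> X" "card I = rk M X" using rk_witness by blast
  obtain J where J: "J \<in> indeps M" "J \<subseteq> X \<union> Y" "card J = rk M (X \<union> Y)"
    using rk_witness by blast
  obtain x where x: "x \<in> J - I" "insert x I \<in> indeps M" using augment I J assms by metis
  have c: "card (insert x I) = Suc (card I)" using x indep_finite[OF I(1)] by simp
  have "x \<notin> X" using card_le_rk[OF x(2), of X] I c by auto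
  moreover have "rk M X < rk M (insert x X)"
    using card_le_rk[OF x(2), of "insert x X"] I c by fastforce
  ultimately show ?thesis using x J by blast
qed

lemma rk_union_spanning:
  assumes "I \<subseteq> X" "rk M I = rk M X"
  shows "rk M (I \<union> A) = rk M (X \<union> A)"
proof (rule ccontr)
  assume "\<not> ?thesis"
  moreover have "I \<union> A \<union> X = X \<union> A" using assms by blast
  ultimately have "rk M (I \<union> A) < rk M (I \<union> A \<union> X)"
    using rk_mono[of "I \<union> A" "X \<union> A"] assms(1) by fastforce
  then obtain x where x: "x \<in> X" "rk M (I \<union> A) < rk M (insert x (I \<union> A))" using rk_jump by blast
  obtain K where K: "K \<in> indeps M" "K \<subseteq> I" "card K = rk M I" using rk_witness by blast
  obtain L where L: "L \<in> indeps M" "K \<subseteq> L" "L \<subseteq> insert x (I \<union> A)"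
    "card L = rk M (insert x (I \<union> A))"
    using extend[OF K(1), of "insert x (I \<union> A)"] K(2) by blast
  have "x \<in> L" using L x card_le_rk[of L "I \<union> A"] by fastforce
  then have i: "insert x K \<in> indeps M" using L indep_subset by auto
  then have "card (insert x K) \<le> rk M X" using x K assms card_le_rk by (meson insert_subset order_trans)
  then have "x \<in> K" using K assms indep_finite[OF K(1)] by (metis card_insert_disjoint Suc_n_not_le_n)
  then show False using x K by (metis Un_iff insert_absorb less_irrefl subsetD)
qed

lemma rk_le_card: "finite X \<Longrightarrow> rk M X \<le> card X"
  using rk_witness[of X] card_mono[of X] by metis

lemma indep_if_rk:
  assumes "finite X" "rk M X = card X"
  shows "X \<in> indeps M"
proof -
  obtain I where "I \<in> indeps M" "I \<subseteq> X" "card I = rk M X" using rk_witness by blast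
  then show ?thesis using assms card_subset_eq by metis
qed

end

context
  fixes M :: "'a independence_system" and A B T :: "'a set"
  assumes M: "matroid M" and T: "finite T" "ground M \<inter> T = {}"
begin

lemma card_split:
  assumes "I \<subseteq> ground M \<union> T"
  shows "card I = card (I \<inter> ground M) + card (I \<inter> T)"
proof -
  have "finite (ground M)" using M unfolding matroid_def by blast
  then have "card ((I \<inter> ground M) \<union> (I \<inter> T)) = card (I \<inter> ground M) + card (I \<inter> T)"
    using T by (intro card_Un_disjoint) auto
  moreover have "(I \<inter> ground M) \<union> (I \<inter> T) = I" using assms by blast
  ultimately show ?thesis by simp
qed

lemma indeps_free_ext_iff:
  "I \<in> indeps (free_ext M A B T) \<longleftrightarrow>
    I \<subseteq> ground M \<union> (T \<inter> B) \<and> I \<inter> ground M \<in> indeps M \<and>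
    card I \<le> rk M ((I \<inter> ground M) \<union> A)"
  (is "_ \<longleftrightarrow> ?R")
proof
  have fS: "finite (ground M)" using M unfolding matroid_def by blast
  assume "I \<in> indeps (free_ext M A B T)"
  then have I: "I \<subseteq> ground M \<union> T"
    and m: "min (rk M ((I \<inter> ground M) \<union> A)) (rk M (I \<inter> ground M) + card (I \<inter> T \<inter> B)) = card I"
    unfolding free_ext_def free_ext_rk_def by (auto simp: Let_def)
  have 1: "rk M (I \<inter> ground M) \<le> card (I \<inter> ground M)" using rk_le_card[OF M] fS by blast
  have 2: "card (I \<inter> T \<inter> B) \<le> card (I \<inter> T)" using T by (intro card_mono) auto
  have "rk M (I \<inter> ground M) = card (I \<inter> ground M)" "card (I \<inter> T \<inter> B) = card (I \<inter> T)"
    using 1 2 m card_split[OF I] by linarith+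
  moreover from this(2) have "I \<inter> T \<inter> B = I \<inter> T"
    using T by (intro card_subset_eq) auto
  ultimately show ?R using indep_if_rk[OF M] fS I m by auto
next
  assume R: ?R
  then have "I \<subseteq> ground M \<union> T" "I \<inter> T \<inter> B = I \<inter> T" using T by auto
  then show "I \<in> indeps (free_ext M A B T)"
    using R card_split[of I] rk_indep[OF M, of "I \<inter> ground M"]
    unfolding free_ext_def free_ext_rk_def by (auto simp: Let_def)
qed

lemma insert_free_ext:
  assumes I: "I \<in> indeps (free_ext M A B T)" and x: "x \<in> ground M \<union> (T \<inter> B)" "x \<notin> I"
    and "x \<in> ground M \<Longrightarrow> insert x (I \<inter> ground M) \<in> indeps M"
    and "card I < rk M (insert x I \<inter> ground M \<union> A)"
  shows "insert x I \<in> indeps (free_ext M A B T)"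
proof -
  have "finite (ground M)" using M unfolding matroid_def by blast
  moreover have "I \<subseteq> ground M \<union> T" using I unfolding indeps_free_ext_iff by blast
  ultimately have "finite I" using T finite_subset by blast
  then have "card (insert x I) = Suc (card I)" using x by simp
  moreover have "insert x I \<inter> ground M \<in> indeps M"
    using assms unfolding indeps_free_ext_iff by (cases "x \<in> ground M") auto
  ultimately show ?thesis using assms unfolding indeps_free_ext_iff by auto
qed

lemma augment_free_ext:
  assumes I: "I \<in> indeps (free_ext M A B T)" and J: "J \<in> indeps (free_ext M A B T)"
    and lt: "card I < card J"
  shows "\<exists>x\<in>J - I. insert x I \<in> indeps (free_ext M A B T)"
proof -
  note I' = I[unfolded indeps_free_ext_iff] and J' = J[unfolded indeps_free_ext_iff]
  show ?thesis
  proof (cases "card I < rk M (I \<inter> ground M \<union> A)")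
    case True
    have up: "card I < rk M (insert x I \<inter> ground M \<union> A)" for x
      using True rk_mono[OF M, of "I \<inter> ground M \<union> A" "insert x I \<inter> ground M \<union> A"] by fastforce
    show ?thesis
    proof (cases "J \<inter> T \<subseteq> I")
      case True
      then have "card (J \<inter> T) \<le> card (I \<inter> T)" using T by (intro card_mono) auto
      moreover have "card J = card (J \<inter> ground M) + card (J \<inter> T)"
        "card I = card (I \<inter> ground M) + card (I \<inter> T)"
        using I' J' by (blast intro: card_split)+
      ultimately have "card (I \<inter> ground M) < card (J \<inter> ground M)" using lt by linarith
      then obtain x where x: "x \<in> J \<inter> ground M - I \<inter> ground M"
        "insert x (I \<inter> ground M) \<in> indeps M"
        using augment[OF M] I' J' by blast
      then show ?thesis using insert_free_ext[OF I, of x] up[of x] by blast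
    next
      case False
      then obtain x where x: "x \<in> J \<inter> T" "x \<notin> I" by blast
      moreover have "x \<notin> ground M" using x T by blast
      moreover have "x \<in> ground M \<union> (T \<inter> B)" using x J' by blast
      ultimately show ?thesis using insert_free_ext[OF I, of x] up[of x] by blast
    qed
  next
    case False
    have "rk M (I \<inter> ground M \<union> A) < rk M (J \<inter> ground M \<union> A)" using False lt J' by linarith
    also have "\<dots> \<le> rk M ((I \<inter> ground M \<union> A) \<union> J \<inter> ground M)" by (rule rk_mono[OF M]) blast
    finally obtain x where x: "x \<in> J \<inter> ground M"
      "rk M (I \<inter> ground M \<union> A) < rk M (insert x (I \<inter> ground M \<union> A))"
      using rk_jump[OF M] by blast
    have xI: "x \<notin> I" using x by (auto simp: insert_absorb)
    have "insert x (I \<inter> ground M) \<in> indeps M"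
    proof (rule ccontr)
      assume n: "insert x (I \<inter> ground M) \<notin> indeps M"
      have fI: "finite (I \<inter> ground M)" using indep_finite[OF M] I' by blast
      have "rk M (insert x (I \<inter> ground M)) < card (insert x (I \<inter> ground M))"
        using n fI indep_if_rk[OF M] rk_le_card[OF M] by (metis finite_insert le_neq_implies_less)
      then have "rk M (insert x (I \<inter> ground M)) \<le> rk M (I \<inter> ground M)"
        using xI fI rk_indep[OF M, of "I \<inter> ground M"] I' by simp
      then have "rk M (I \<inter> ground M) = rk M (insert x (I \<inter> ground M))"
        using rk_mono[OF M, of "I \<inter> ground M" "insert x (I \<inter> ground M)"] by (simp add: subset_insertI)
      then have "rk M (I \<inter> ground M \<union> A) = rk M (insert x (I \<inter> ground M) \<union> A)"
        by (intro rk_union_spanning[OF M]) auto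
      then show False using x by simp
    qed
    moreover have "card I < rk M (insert x I \<inter> ground M \<union> A)"
      using I' x by (simp add: Int_insert_left)
    ultimately show ?thesis using insert_free_ext[OF I, of x] x xI by blast
  qed
qed

lemma matroid_free_ext: "matroid (free_ext M A B T)"
proof -
  have fS: "finite (ground M)" using M unfolding matroid_def by blast
  have fin: "finite I" if "I \<in> indeps (free_ext M A B T)" for I
    using that finite_subset[of I "ground M \<union> T"] fS T unfolding indeps_free_ext_iff by auto
  have "J \<in> indeps (free_ext M A B T)" if I: "I \<in> indeps (free_ext M A B T)" and JI: "J \<subseteq> I" for I J
    using JI fin[OF I]
  proof (induction "card (I - J)" arbitrary: J)
    case 0
    then show ?case using I by simp
  next
    case (Suc n)
    then obtain x where x: "x \<in> I" "x \<notin> J"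
      using card_gt_0_iff[of "I - J"] by fastforce
    have "I - insert x J = (I - J) - {x}" by blast
    then have "n = card (I - insert x J)" using Suc.hyps(2) Suc.prems(2) x by simp
    then have K: "insert x J \<in> indeps (free_ext M A B T)"
      using Suc.hyps(1) Suc.prems x by simp
    have fJ: "finite J" using Suc.prems by (rule finite_subset)
    note K' = K[unfolded indeps_free_ext_iff]
    have i: "J \<inter> ground M \<in> indeps M"
      by (rule indep_subset[OF M, of "insert x J \<inter> ground M"]) (use K' in auto)
    have "card J \<le> rk M (J \<inter> ground M \<union> A)"
    proof (cases "card (J \<inter> T) = 0")
      case True
      have "card J = card (J \<inter> ground M)" using card_split[of J] True K' by auto
      then show ?thesis using card_le_rk[OF M i] by auto
    next
      case False
      show ?thesis
      proof (cases "x \<in> ground M")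
        case True
        obtain L where L: "L \<in> indeps M" "insert x J \<inter> ground M \<subseteq> L"
          "L \<subseteq> insert x J \<inter> ground M \<union> A" "card L = rk M (insert x J \<inter> ground M \<union> A)"
          using extend[OF M, of "insert x J \<inter> ground M" "insert x J \<inter> ground M \<union> A"] K'
          by auto
        have "L - {x} \<in> indeps M" by (rule indep_subset[OF M L(1)]) blast
        then have "card (L - {x}) \<le> rk M (J \<inter> ground M \<union> A)"
          by (rule card_le_rk[OF M]) (use L in blast)
        moreover have "card J < card L" using K' L x fJ by simp
        moreover have "card L - 1 \<le> card (L - {x})" by (simp add: card_Diff_singleton_if)
        ultimately show ?thesis by linarith
      next
        case False
        then have "insert x J \<inter> ground M = J \<inter> ground M" by blast
        then show ?thesis using K' x fJ by auto
      qed
    qed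
    then show ?case using K' i unfolding indeps_free_ext_iff by simp
  qed
  moreover have "{} \<in> indeps (free_ext M A B T)"
    using M unfolding indeps_free_ext_iff matroid_def by simp
  moreover have "ground (free_ext M A B T) = ground M \<union> T" by (simp add: free_ext_def)
  moreover have "indeps (free_ext M A B T) \<subseteq> Pow (ground M \<union> T)"
    unfolding free_ext_def by auto
  ultimately show ?thesis
    using fS T by (subst matroid_def) (simp add: augment_free_ext)
qed

lemma rk_free_ext:
  assumes Z: "Z \<subseteq> ground M \<union> T"
  shows "rk (free_ext M A B T) Z = free_ext_rk M A B T Z"
proof (rule antisym)
  let ?X = "Z \<inter> ground M" and ?Y = "Z \<inter> T \<inter> B"
  obtain I where I: "I \<in> indeps (free_ext M A B T)" "I \<subseteq> Z" "card I = rk (free_ext M A B T) Z"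
    using rk_witness[OF matroid_free_ext] by blast
  have "card I = free_ext_rk M A B T I" using I unfolding free_ext_def by simp
  also have "\<dots> \<le> free_ext_rk M A B T Z"
  proof -
    have "rk M (I \<inter> ground M \<union> A) \<le> rk M (?X \<union> A)" "rk M (I \<inter> ground M) \<le> rk M ?X"
      using I(2) by (intro rk_mono[OF M]; blast)+
    moreover have "card (I \<inter> T \<inter> B) \<le> card ?Y" using I(2) T by (intro card_mono) auto
    ultimately show ?thesis unfolding free_ext_rk_def Let_def by linarith
  qed
  finally show "rk (free_ext M A B T) Z \<le> free_ext_rk M A B T Z" using I by simp
  obtain J where J: "J \<in> indeps M" "J \<subseteq> ?X" "card J = rk M ?X" using rk_witness[OF M] by blast
  have JA: "rk M (J \<union> A) = rk M (?X \<union> A)"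
    using rk_union_spanning[OF M J(2)] rk_indep[OF M J(1)] J(3) by simp
  have "min (card ?Y) (rk M (?X \<union> A) - rk M ?X) \<le> card ?Y" by simp
  then obtain K where K: "K \<subseteq> ?Y" "card K = min (card ?Y) (rk M (?X \<union> A) - rk M ?X)" "finite K"
    by (meson obtain_subset_with_card_n)
  have "card (J \<union> K) = card J + card K"
    using K J T indep_finite[OF M J(1)] by (intro card_Un_disjoint) auto
  moreover have "rk M ?X \<le> rk M (?X \<union> A)" by (rule rk_mono[OF M]) blast
  ultimately have c: "card (J \<union> K) = free_ext_rk M A B T Z"
    using K J unfolding free_ext_rk_def Let_def by linarith
  have "(J \<union> K) \<inter> ground M = J" using J K T by blast
  moreover have "card (J \<union> K) \<le> rk M (?X \<union> A)" unfolding c free_ext_rk_def by (simp add: Let_def)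
  ultimately have "J \<union> K \<in> indeps (free_ext M A B T)"
    unfolding indeps_free_ext_iff using J K JA by auto
  then have "card (J \<union> K) \<le> rk (free_ext M A B T) Z"
    by (rule card_le_rk[OF matroid_free_ext]) (use J K in blast)
  then show "free_ext_rk M A B T Z \<le> rk (free_ext M A B T) Z" using c by simp
qed

end

end

theory Submission
  imports Defs
begin

text \<open>A set is cyclic iff deleting any of its elements preserves the rank. The rank of \<open>X \<union> Y\<close> in
  the principal sum is the minimum of \<open>a = rk M (X \<union> A) + rk N Y\<close> and
  \<open>b = rk M X + rk N (Y - B) + card (Y \<inter> B)\<close>, each of which drops by at most one when an element is
  deleted. If \<open>a < b\<close>, then \<open>X \<union> Y\<close> is cyclic iff no deletion lowers \<open>a\<close>, which is (2). If
  \<open>b \<le> a\<close>, then no deletion may lower \<open>b\<close>; elements of \<open>Y \<inter> B\<close> always do so, which leaves (1).\<close>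

section \<open>Cyclic sets and coloops in terms of rank\<close>

lemma rk_diff_union:
  assumes M: "matroid M" and "rk M (C - {z}) = rk M C" "C \<subseteq> Z" "z \<in> C"
  shows "rk M (Z - {z}) = rk M Z"
proof -
  \<comment> \<open>\<open>C - {z}\<close> spans \<open>C\<close>, so adjoining
    \<open>Z - {z}\<close> to either gives the same rank; the two unions are \<open>Z - {z}\<close>
    and \<open>Z\<close>.\<close>
  have "rk M (C - {z} \<union> (Z - {z})) = rk M (C \<union> (Z - {z}))"
    using assms by (intro rk_union_spanning[OF M]) auto
  moreover have "C - {z} \<union> (Z - {z}) = Z - {z}" "C \<union> (Z - {z}) = Z" using assms by auto
  ultimately show ?thesis by simp
qed

text \<open>Removing \<open>z\<close> from a basis of \<open>Z\<close> costs at most one element.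
  This limits how far the second term of the minimum can fall under a deletion.\<close>

lemma rk_le_Suc_rk_diff:
  assumes M: "matroid M"
  shows "rk M Z \<le> Suc (rk M (Z - {z}))"
proof -
  obtain I where I: "I \<in> indeps M" "I \<subseteq> Z" "card I = rk M Z" using rk_witness[OF M] by blast
  have "card (I - {z}) \<le> rk M (Z - {z})"
    using I indep_subset[OF M I(1), of "I - {z}"] by (intro card_le_rk[OF M]) auto
  moreover have "card I - 1 \<le> card (I - {z})" by (simp add: card_Diff_singleton_if)
  ultimately show ?thesis using I(3) by linarith
qed

text \<open>\<open>C - {z}\<close> is independent and \<open>C\<close> is not, which forces both
  ranks to be \<open>card C - 1\<close>.\<close>

lemma rk_circuit:
  assumes M: "matroid M" and C: "circuit M C" and z: "z \<in> C"
  shows "rk M (C - {z}) = rk M C"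
proof -
  have "finite (ground M)" using M unfolding matroid_def by blast
  then have fin: "finite C" using C finite_subset unfolding circuit_def by blast
  have "C - {z} \<in> indeps M" using C z unfolding circuit_def by blast
  then have "rk M (C - {z}) = card C - 1" using rk_indep[OF M] z fin by simp
  moreover have "rk M C < card C"
    using C indep_if_rk[OF M fin] rk_le_card[OF M fin] unfolding circuit_def by linarith
  moreover have "rk M (C - {z}) \<le> rk M C" by (rule rk_mono[OF M]) blast
  ultimately show ?thesis by linarith
qed

lemma dependent_contains_circuit:
  assumes "finite D" "D \<subseteq> ground M" "D \<notin> indeps M"
  shows "\<exists>C\<subseteq>D. circuit M C"
  using assms
proof (induction D rule: finite_psubset_induct)
  case (psubset D)
  show ?case
  proof (cases "\<exists>E. E \<subset> D \<and> E \<notin> indeps M")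
    case True
    then obtain E where "E \<subset> D" "E \<notin> indeps M" by blast
    then show ?thesis using psubset.IH[of E] psubset.prems by blast
  next
    case False
    then show ?thesis using psubset.prems unfolding circuit_def by blast
  qed
qed

text \<open>Trades circuits for ranks, which the principal sum gives by an explicit formula.\<close>

lemma cyclic_iff_rk:
  assumes M: "matroid M" and Z: "Z \<subseteq> ground M"
  shows "cyclic M Z \<longleftrightarrow> (\<forall>z\<in>Z. rk M (Z - {z}) = rk M Z)"
proof
  assume "cyclic M Z"
  then obtain \<C> where \<C>: "\<forall>C\<in>\<C>. circuit M C" "Z = \<Union>\<C>" unfolding cyclic_def by blast
  show "\<forall>z\<in>Z. rk M (Z - {z}) = rk M Z"
  proof
    fix z assume "z \<in> Z"
    then obtain C where "circuit M C" "C \<subseteq> Z" "z \<in> C" using \<C> by blast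
    then show "rk M (Z - {z}) = rk M Z" using rk_diff_union[OF M rk_circuit[OF M]] by simp
  qed
next
  assume R: "\<forall>z\<in>Z. rk M (Z - {z}) = rk M Z"
  have "\<exists>C. circuit M C \<and> z \<in> C \<and> C \<subseteq> Z" if z: "z \<in> Z" for z
  proof -
    have "rk M (Z - {z}) = rk M Z" using R z by simp
    then obtain I where I: "I \<in> indeps M" "I \<subseteq> Z - {z}" "card I = rk M Z"
      using rk_witness[OF M, of "Z - {z}"] by metis
    have fin: "finite I" using indep_finite[OF M I(1)] .
    \<comment> \<open>A basis \<open>I\<close> of \<open>Z - {z}\<close> already has the rank of
      \<open>Z\<close>, so adding \<open>z\<close> makes it dependent. The circuit found inside must
      pass through \<open>z\<close>, since \<open>I\<close> is independent.\<close>
    have "card (insert z I) = Suc (rk M Z)" using I fin by (subst card_insert_disjoint) auto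
    moreover have sub: "insert z I \<subseteq> Z" using I(2) z by blast
    ultimately have "insert z I \<notin> indeps M" using card_le_rk[OF M, of "insert z I" Z] by auto
    moreover have "finite (insert z I)" using fin by simp
    moreover have "insert z I \<subseteq> ground M" using sub Z by (rule subset_trans)
    ultimately obtain C where C: "C \<subseteq> insert z I" "circuit M C"
      using dependent_contains_circuit[of "insert z I" M] by auto
    have "C \<notin> indeps M" using C(2) unfolding circuit_def by simp
    then have "\<not> C \<subseteq> I" using indep_subset[OF M I(1)] by auto
    then have "z \<in> C" using C(1) by blast
    moreover have "C \<subseteq> Z" using C(1) sub by (rule subset_trans)
    ultimately show ?thesis using C(2) by blast
  qed
  then have "Z = \<Union>{C. circuit M C \<and> C \<subseteq> Z}" by blast
  then show "cyclic M Z" unfolding cyclic_def by (intro exI[of _ "{C. circuit M C \<and> C \<subseteq> Z}"]) simp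
qed

text \<open>Turns maximality under inclusion into maximal size: an independent subset of
  \<open>W\<close> that is too small could be extended within \<open>W\<close>.\<close>

lemma basis_restriction_iff:
  assumes M: "matroid M"
  shows "basis (restriction M W) I \<longleftrightarrow> I \<in> indeps M \<and> I \<subseteq> W \<and> card I = rk M W"
proof
  assume b: "basis (restriction M W) I"
  then have "I \<in> indeps M" "I \<subseteq> W" unfolding basis_def restriction_def by auto
  moreover from this obtain J where "J \<in> indeps M" "I \<subseteq> J" "J \<subseteq> W" "card J = rk M W"
    using extend[OF M] by blast
  ultimately show "I \<in> indeps M \<and> I \<subseteq> W \<and> card I = rk M W"
    using b unfolding basis_def restriction_def by auto
next
  assume I: "I \<in> indeps M \<and> I \<subseteq> W \<and> card I = rk M W"
  have "J = I" if "J \<in> indeps M" "J \<subseteq> W" "I \<subseteq> J" for J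
    using card_seteq[OF indep_finite[OF M that(1)] that(3)] card_le_rk[OF M that(1,2)] I by simp
  then show "basis (restriction M W) I" using I unfolding basis_def restriction_def by auto
qed

text \<open>A basis of the restriction that avoids \<open>e\<close> is an independent subset of
  \<open>W - {e}\<close> of size \<open>rk M W\<close>.\<close>

lemma coloop_restriction_iff:
  assumes M: "matroid M" and W: "W \<subseteq> ground M"
  shows "coloop (restriction M W) e \<longleftrightarrow> e \<in> W \<and> rk M (W - {e}) \<noteq> rk M W"
proof -
  have "(\<forall>I. basis (restriction M W) I \<longrightarrow> e \<in> I) \<longleftrightarrow> rk M (W - {e}) \<noteq> rk M W"
  proof
    assume all: "\<forall>I. basis (restriction M W) I \<longrightarrow> e \<in> I"
    obtain I where I: "I \<in> indeps M" "I \<subseteq> W - {e}" "card I = rk M (W - {e})"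
      using rk_witness[OF M, of "W - {e}"] by blast
    show "rk M (W - {e}) \<noteq> rk M W"
    proof
      assume "rk M (W - {e}) = rk M W"
      then have "basis (restriction M W) I" unfolding basis_restriction_iff[OF M] using I by auto
      then show False using all I(2) by blast
    qed
  next
    assume ne: "rk M (W - {e}) \<noteq> rk M W"
    have "rk M (W - {e}) \<le> rk M W" by (rule rk_mono[OF M]) blast
    then have "rk M (W - {e}) < rk M W" using ne by simp
    then have "\<not> I \<subseteq> W - {e}" if "I \<in> indeps M" "card I = rk M W" for I
      using card_le_rk[OF M that(1), of "W - {e}"] that(2) by auto
    then show "\<forall>I. basis (restriction M W) I \<longrightarrow> e \<in> I"
      unfolding basis_restriction_iff[OF M] by blast
  qed
  then show ?thesis using W unfolding coloop_def restriction_def by auto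
qed

section \<open>Matroid unions and direct sums with loops\<close>

text \<open>Induction on how far the two decompositions are from matching: augmenting one summand either
  adds an element of \<open>J\<^sub>1 \<union> J\<^sub>2\<close>, or moves an element of \<open>I\<^sub>2 \<inter> J\<^sub>1\<close> (or \<open>I\<^sub>1 \<inter> J\<^sub>2\<close>) to the side it
  has in \<open>J\<^sub>1 \<union> J\<^sub>2\<close>.\<close>

lemma augment_disjoint_unions:
  assumes "matroid G" "matroid H"
    and "I\<^sub>1 \<in> indeps G" "I\<^sub>2 \<in> indeps H" "I\<^sub>1 \<inter> I\<^sub>2 = {}"
    and "J\<^sub>1 \<in> indeps G" "J\<^sub>2 \<in> indeps H" "J\<^sub>1 \<inter> J\<^sub>2 = {}"
    and "card I\<^sub>1 + card I\<^sub>2 < card J\<^sub>1 + card J\<^sub>2"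
  shows "\<exists>x\<in>J\<^sub>1 \<union> J\<^sub>2 - (I\<^sub>1 \<union> I\<^sub>2). \<exists>K\<^sub>1\<in>indeps G. \<exists>K\<^sub>2\<in>indeps H. insert x (I\<^sub>1 \<union> I\<^sub>2) = K\<^sub>1 \<union> K\<^sub>2"
  using assms
proof (induction "card (I\<^sub>1 \<inter> J\<^sub>2) + card (I\<^sub>2 \<inter> J\<^sub>1)" arbitrary: G H I\<^sub>1 I\<^sub>2 J\<^sub>1 J\<^sub>2 rule: less_induct)
  case (less I\<^sub>1 I\<^sub>2 J\<^sub>1 J\<^sub>2 G H)
  \<comment> \<open>Stated for arbitrary matroids and sets with the same measure, so that it also
    applies with the two summands exchanged.\<close>
  have step: "\<exists>x\<in>J\<^sub>1' \<union> J\<^sub>2' - (I\<^sub>1' \<union> I\<^sub>2'). \<exists>K\<^sub>1\<in>indeps G'. \<exists>K\<^sub>2\<in>indeps H'.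
      insert x (I\<^sub>1' \<union> I\<^sub>2') = K\<^sub>1 \<union> K\<^sub>2"
    if meas: "card (I\<^sub>1' \<inter> J\<^sub>2') + card (I\<^sub>2' \<inter> J\<^sub>1') = card (I\<^sub>1 \<inter> J\<^sub>2) + card (I\<^sub>2 \<inter> J\<^sub>1)"
      and G: "matroid G'" and H: "matroid H'"
      and I: "I\<^sub>1' \<in> indeps G'" "I\<^sub>2' \<in> indeps H'" "I\<^sub>1' \<inter> I\<^sub>2' = {}"
      and J: "J\<^sub>1' \<in> indeps G'" "J\<^sub>2' \<in> indeps H'" "J\<^sub>1' \<inter> J\<^sub>2' = {}"
      and lt: "card I\<^sub>1' + card I\<^sub>2' < card J\<^sub>1' + card J\<^sub>2'" "card I\<^sub>1' < card J\<^sub>1'"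
    for G' H' :: "'a independence_system" and I\<^sub>1' I\<^sub>2' J\<^sub>1' J\<^sub>2'
  proof -
    obtain x where x: "x \<in> J\<^sub>1'" "x \<notin> I\<^sub>1'" "insert x I\<^sub>1' \<in> indeps G'"
      using augment[OF G I(1) J(1) lt(2)] by blast
    show ?thesis
    proof (cases "x \<in> I\<^sub>2'")
      case False
      then have "x \<in> J\<^sub>1' \<union> J\<^sub>2' - (I\<^sub>1' \<union> I\<^sub>2')" using x by blast
      then show ?thesis using x I by (metis Un_insert_left)
    next
      case True
      have fin: "finite I\<^sub>1'" "finite I\<^sub>2'" using indep_finite[OF G I(1)] indep_finite[OF H I(2)] .
      \<comment> \<open>Here \<open>x\<close> moves from the second part to the first. As
        \<open>x\<close> is not in \<open>J\<^sub>2'\<close>, the first intersection is unchanged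
        while the second loses \<open>x\<close>, so the measure drops.\<close>
      have eq: "insert x I\<^sub>1' \<inter> J\<^sub>2' = I\<^sub>1' \<inter> J\<^sub>2'" using x J by blast
      have "card ((I\<^sub>2' - {x}) \<inter> J\<^sub>1') < card (I\<^sub>2' \<inter> J\<^sub>1')"
        using x True fin by (intro psubset_card_mono) auto
      then have m: "card (insert x I\<^sub>1' \<inter> J\<^sub>2') + card ((I\<^sub>2' - {x}) \<inter> J\<^sub>1')
          < card (I\<^sub>1 \<inter> J\<^sub>2) + card (I\<^sub>2 \<inter> J\<^sub>1)"
        unfolding eq using meas by linarith
      have "card (insert x I\<^sub>1') + card (I\<^sub>2' - {x}) = card I\<^sub>1' + card I\<^sub>2'"
        using x True fin card_Suc_Diff1[of I\<^sub>2' x] by simp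
      moreover have "I\<^sub>2' - {x} \<in> indeps H'" using indep_subset[OF H I(2)] by blast
      moreover have "insert x I\<^sub>1' \<inter> (I\<^sub>2' - {x}) = {}" using I by blast
      moreover have "insert x I\<^sub>1' \<union> (I\<^sub>2' - {x}) = I\<^sub>1' \<union> I\<^sub>2'" using True by blast
      ultimately show ?thesis using less.hyps[OF m G H x(3)] J lt(1) by simp
    qed
  qed
  note prems = less.prems
  show ?case
  proof (cases "card I\<^sub>1 < card J\<^sub>1")
    case True
    then show ?thesis using step[OF refl prems] by blast
  next
    case False
    then have "card I\<^sub>2 < card J\<^sub>2" using prems(9) by linarith
    \<comment> \<open>The first parts do not give room to augment, so the second parts do: the roles
      of \<open>G\<close> and \<open>H\<close> are swapped.\<close>
    then have "\<exists>x\<in>J\<^sub>2 \<union> J\<^sub>1 - (I\<^sub>2 \<union> I\<^sub>1). \<exists>K\<^sub>1\<in>indeps H. \<exists>K\<^sub>2\<in>indeps G.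
        insert x (I\<^sub>2 \<union> I\<^sub>1) = K\<^sub>1 \<union> K\<^sub>2"
      using prems by (intro step) (auto simp: Int_commute add.commute)
    then show ?thesis by (metis Un_commute)
  qed
qed

lemma matroid_matroid_union:
  assumes G: "matroid G" and H: "matroid H"
  shows "matroid (matroid_union G H)"
proof -
  define U where "U = {I \<union> J | I J. I \<in> indeps G \<and> J \<in> indeps H}"
  have UI: "I \<union> J \<in> U" if "I \<in> indeps G" "J \<in> indeps H" for I J
    using that unfolding U_def by blast
  have UE: "\<exists>I\<in>indeps G. \<exists>J\<in>indeps H. K = I \<union> J" if "K \<in> U" for K
    using that unfolding U_def by blast
  \<comment> \<open>Discarding the overlap from the second part makes cardinalities add up, as
    \<open>augment_disjoint_unions\<close> requires.\<close>
  have disj: "\<exists>I\<in>indeps G. \<exists>J\<in>indeps H. K = I \<union> J \<and> I \<inter> J = {} \<and> card K = card I + card J"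
    if "K \<in> U" for K
  proof -
    obtain I J where IJ: "I \<in> indeps G" "J \<in> indeps H" "K = I \<union> J" using UE[OF \<open>K \<in> U\<close>] by blast
    have J': "J - I \<in> indeps H" using indep_subset[OF H IJ(2)] by simp
    have "K = I \<union> (J - I)" "I \<inter> (J - I) = {}" using IJ by auto
    moreover from this have "card K = card I + card (J - I)"
      using card_Un_disjoint[OF indep_finite[OF G IJ(1)] indep_finite[OF H J']] by simp
    ultimately show ?thesis using IJ(1) J' by (intro bexI[of _ I] bexI[of _ "J - I"]) simp_all
  qed
  have "finite (ground K)" "{} \<in> indeps K" "indeps K \<subseteq> Pow (ground K)"
    if "matroid K" for K :: "'a independence_system"
    using that unfolding matroid_def by simp_all
  note mat = this[OF G] this[OF H]
  have "finite (ground G \<union> ground H)" using mat by simp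
  moreover have "U \<subseteq> Pow (ground G \<union> ground H)" using mat(3,6) unfolding U_def by blast
  moreover have "{} \<in> U" using UI[OF mat(2,5)] by simp
  moreover have "L \<in> U" if "K \<in> U" "L \<subseteq> K" for K L
  proof -
    obtain I J where IJ: "I \<in> indeps G" "J \<in> indeps H" "K = I \<union> J" using UE[OF \<open>K \<in> U\<close>] by blast
    have "L = (L \<inter> I) \<union> (L \<inter> J)" using IJ that by blast
    moreover have "L \<inter> I \<in> indeps G" "L \<inter> J \<in> indeps H"
      using indep_subset[OF G IJ(1)] indep_subset[OF H IJ(2)] by simp_all
    ultimately show ?thesis using UI by metis
  qed
  moreover have "\<exists>x\<in>L - K. insert x K \<in> U" if K: "K \<in> U" and L: "L \<in> U" and lt: "card K < card L"
    for K L
  proof -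
    obtain I\<^sub>1 I\<^sub>2 where I: "I\<^sub>1 \<in> indeps G" "I\<^sub>2 \<in> indeps H" "K = I\<^sub>1 \<union> I\<^sub>2" "I\<^sub>1 \<inter> I\<^sub>2 = {}"
      "card K = card I\<^sub>1 + card I\<^sub>2" using disj[OF K] by (elim bexE conjE)
    obtain J\<^sub>1 J\<^sub>2 where J: "J\<^sub>1 \<in> indeps G" "J\<^sub>2 \<in> indeps H" "L = J\<^sub>1 \<union> J\<^sub>2" "J\<^sub>1 \<inter> J\<^sub>2 = {}"
      "card L = card J\<^sub>1 + card J\<^sub>2" using disj[OF L] by (elim bexE conjE)
    have "card I\<^sub>1 + card I\<^sub>2 < card J\<^sub>1 + card J\<^sub>2" using lt I(5) J(5) by simp
    from augment_disjoint_unions[OF G H I(1,2,4) J(1,2,4) this]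
    show ?thesis unfolding I(3) J(3) by (elim bexE rev_bexI) (simp add: UI)
  qed
  ultimately have "matroid \<lparr>ground = ground G \<union> ground H, indeps = U\<rparr>"
    unfolding matroid_def by simp
  then show ?thesis unfolding matroid_union_def U_def .
qed

text \<open>The only independent set of \<open>uniform 0 S\<close> is \<open>{}\<close>, so just the
  ground set grows.\<close>

lemma matroid_direct_sum_loops:
  assumes N: "matroid N" and "finite S"
  shows "matroid (direct_sum N (uniform 0 S))" "indeps (direct_sum N (uniform 0 S)) = indeps N"
proof -
  show i: "indeps (direct_sum N (uniform 0 S)) = indeps N"
  proof -
    have "indeps (uniform 0 S) = {{}}" unfolding uniform_def by auto
    then show ?thesis unfolding direct_sum_def by simp
  qed
  have "ground (direct_sum N (uniform 0 S)) = ground N \<union> S"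
    unfolding direct_sum_def uniform_def by simp
  with i show "matroid (direct_sum N (uniform 0 S))"
    using assms unfolding matroid_def by auto
qed

section \<open>Rank and cyclic sets of the principal sum\<close>

context
  fixes M N :: "'a independence_system" and A B :: "'a set"
  assumes M: "matroid M" and N: "matroid N"
    and disjoint: "ground M \<inter> ground N = {}"
begin

lemma finite_grounds: "finite (ground M)" "finite (ground N)"
  using M N unfolding matroid_def by blast+

lemma matroid_principal_sum: "matroid (principal_sum M N A B)"
  unfolding principal_sum_def
  by (intro matroid_matroid_union matroid_free_ext matroid_direct_sum_loops)
    (use M N disjoint finite_grounds in auto)

lemma ground_principal_sum: "ground (principal_sum M N A B) = ground M \<union> ground N"
  unfolding principal_sum_def matroid_union_def free_ext_def direct_sum_def uniform_def by auto

lemma indeps_principal_sum: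
  "indeps (principal_sum M N A B) =
    {I \<union> J | I J. I \<in> indeps (free_ext M A B (ground N)) \<and> J \<in> indeps N}"
  unfolding principal_sum_def matroid_union_def
  using matroid_direct_sum_loops(2)[OF N finite_grounds(1)] by simp

text \<open>Each term bounds the size of a union of independent sets. Equality comes from bases of
  \<open>X\<close> and \<open>Y\<close>, enlarged by as many further elements of
  \<open>Y \<inter> B\<close> as the free extension allows.\<close>

lemma rk_principal_sum:
  assumes X: "X \<subseteq> ground M" and Y: "Y \<subseteq> ground N"
  shows "rk (principal_sum M N A B) (X \<union> Y) =
    min (rk M (X \<union> A) + rk N Y) (rk M X + rk N (Y - B) + card (Y \<inter> B))"
proof (rule antisym)
  let ?P = "principal_sum M N A B" and ?F = "free_ext M A B (ground N)"
  note free_iff = indeps_free_ext_iff[OF M finite_grounds(2) disjoint]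
  have fX: "finite X" and fY: "finite Y" using X Y finite_grounds finite_subset by blast+
  show "rk ?P (X \<union> Y) \<le> min (rk M (X \<union> A) + rk N Y) (rk M X + rk N (Y - B) + card (Y \<inter> B))"
  proof -
    obtain K where K: "K \<in> indeps ?P" "K \<subseteq> X \<union> Y" "card K = rk ?P (X \<union> Y)"
      using rk_witness[OF matroid_principal_sum] by blast
    obtain I J where IJ: "I \<in> indeps ?F" "J \<in> indeps N" "K = I \<union> J"
      using K(1) unfolding indeps_principal_sum by blast
    have JY: "J \<subseteq> Y"
    proof -
      have "J \<subseteq> ground N" using IJ(2) N unfolding matroid_def by blast
      then show ?thesis using IJ(3) K(2) X disjoint by blast
    qed
    have I: "I \<inter> ground M \<in> indeps M" "card I \<le> rk M (I \<inter> ground M \<union> A)"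
      "I \<subseteq> ground M \<union> (ground N \<inter> B)"
      using IJ(1) unfolding free_iff by auto
    have IX: "I \<inter> ground M \<subseteq> X" using IJ(3) K(2) Y disjoint by blast
    have "card K \<le> card I + card J" unfolding IJ(3) by (rule card_Un_le)
    moreover have "card J \<le> rk N Y" by (rule card_le_rk[OF N IJ(2) JY])
    moreover have "rk M (I \<inter> ground M \<union> A) \<le> rk M (X \<union> A)"
      by (rule rk_mono[OF M]) (use IX in blast)
    ultimately have a: "card K \<le> rk M (X \<union> A) + rk N Y" using I(2) by linarith
    \<comment> \<open>The elements of \<open>I\<close> outside \<open>ground M\<close> lie in
      \<open>B\<close>, so for the second bound everything in \<open>Y \<inter> B\<close> is counted
      at once, whichever summand it comes from.\<close>
    have "K \<subseteq> (I \<inter> ground M) \<union> ((J - B) \<union> (Y \<inter> B))"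
      using IJ(3) JY K(2) I(3) X disjoint by blast
    moreover have "finite ((I \<inter> ground M) \<union> ((J - B) \<union> (Y \<inter> B)))"
      using finite_subset[OF JY fY] fY finite_grounds by blast
    ultimately have "card K \<le> card ((I \<inter> ground M) \<union> ((J - B) \<union> (Y \<inter> B)))"
      by (simp add: card_mono)
    also have "\<dots> \<le> card (I \<inter> ground M) + (card (J - B) + card (Y \<inter> B))"
      using card_Un_le[of "I \<inter> ground M" "(J - B) \<union> (Y \<inter> B)"] card_Un_le[of "J - B" "Y \<inter> B"]
      by linarith
    also have "card (I \<inter> ground M) \<le> rk M X" by (rule card_le_rk[OF M I(1) IX])
    also have "card (J - B) \<le> rk N (Y - B)"
      by (intro card_le_rk[OF N] indep_subset[OF N IJ(2)]) (use JY in auto)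
    finally show ?thesis using a K(3) by simp
  qed
  obtain I where I: "I \<in> indeps M" "I \<subseteq> X" "card I = rk M X" using rk_witness[OF M] by blast
  obtain J\<^sub>0 where J\<^sub>0: "J\<^sub>0 \<in> indeps N" "J\<^sub>0 \<subseteq> Y - B" "card J\<^sub>0 = rk N (Y - B)"
    using rk_witness[OF N] by blast
  \<comment> \<open>Growing \<open>J\<close> from a basis of \<open>Y - B\<close> keeps its use of
    \<open>Y \<inter> B\<close> small, leaving enough elements for \<open>K\<close>.\<close>
  obtain J where J: "J \<in> indeps N" "J\<^sub>0 \<subseteq> J" "J \<subseteq> Y" "card J = rk N Y"
    using extend[OF N J\<^sub>0(1), of Y] J\<^sub>0(2) by blast
  have fJ: "finite J" using J fY finite_subset by blast
  have fI: "finite I" using I fX finite_subset by blast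
  \<comment> \<open>If the first entry is the minimum, the final set has at least as many elements
    as the second term of the rank formula; otherwise its size is exactly the first term. The
    difference is not truncated, by \<open>XA\<close> below.\<close>
  let ?k = "min (card (Y \<inter> B - J)) (rk M (X \<union> A) - rk M X)"
  obtain K where K: "K \<subseteq> Y \<inter> B - J" "card K = ?k" "finite K"
    by (meson obtain_subset_with_card_n min.cobounded1)
  have XA: "rk M X \<le> rk M (X \<union> A)" by (rule rk_mono[OF M]) blast
  have IA: "rk M (I \<union> A) = rk M (X \<union> A)"
    using rk_union_spanning[OF M I(2)] rk_indep[OF M I(1)] I(3) by simp
  have "I \<inter> K = {}" using I(2) K(1) X Y disjoint by blast
  then have IK: "card (I \<union> K) = rk M X + ?k"
    using card_Un_disjoint[OF fI K(3)] I(3) K(2) by simp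
  have "(I \<union> K) \<inter> ground M = I" using I K X Y disjoint by blast
  then have "I \<union> K \<in> indeps ?F"
    unfolding free_iff using I IA IK K X Y XA by auto
  then have "I \<union> K \<union> J \<in> indeps ?P" unfolding indeps_principal_sum using J(1) by blast
  then have "card (I \<union> K \<union> J) \<le> rk ?P (X \<union> Y)"
    by (rule card_le_rk[OF matroid_principal_sum]) (use I K J in blast)
  moreover have "(I \<union> K) \<inter> J = {}" using K(1) I(2) J(3) X Y disjoint by blast
  then have "card (I \<union> K \<union> J) = rk M X + ?k + rk N Y"
    unfolding IK[symmetric] J(4)[symmetric] using fI fJ K(3) by (intro card_Un_disjoint) simp_all
  moreover have "rk N (Y - B) + card (Y \<inter> B) \<le> card (Y \<inter> B - J) + rk N Y"
  proof -
    have "card (J\<^sub>0 \<union> (Y \<inter> B)) = card J\<^sub>0 + card (Y \<inter> B)"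
      using J\<^sub>0(2) fY finite_subset[of J\<^sub>0 Y] by (intro card_Un_disjoint) auto
    moreover have "card (J\<^sub>0 \<union> (Y \<inter> B)) \<le> card ((Y \<inter> B - J) \<union> J)"
      by (intro card_mono) (use J fY fJ in auto)
    ultimately show ?thesis using card_Un_le[of "Y \<inter> B - J" J] J J\<^sub>0 by linarith
  qed
  ultimately show "min (rk M (X \<union> A) + rk N Y) (rk M X + rk N (Y - B) + card (Y \<inter> B))
      \<le> rk ?P (X \<union> Y)"
    using XA by linarith
qed

text \<open>Since the ground sets are disjoint, deleting an element changes only \<open>X\<close> or
  only \<open>Y\<close>, and the rank formula applies to what remains.\<close>

lemma cyclic_principal_sum_iff_rk:
  assumes X: "X \<subseteq> ground M" and Y: "Y \<subseteq> ground N"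
  defines "f \<equiv> \<lambda>X Y. min (rk M (X \<union> A) + rk N Y) (rk M X + rk N (Y - B) + card (Y \<inter> B))"
  shows "cyclic (principal_sum M N A B) (X \<union> Y) \<longleftrightarrow>
    (\<forall>z\<in>X. f (X - {z}) Y = f X Y) \<and> (\<forall>z\<in>Y. f X (Y - {z}) = f X Y)"
proof -
  have rk: "rk (principal_sum M N A B) (X' \<union> Y') = f X' Y'" if "X' \<subseteq> X" "Y' \<subseteq> Y" for X' Y'
    unfolding f_def using that X Y by (intro rk_principal_sum) auto
  have "rk (principal_sum M N A B) (X \<union> Y - {z}) = f (X - {z}) Y" if "z \<in> X" for z
  proof -
    have "X \<union> Y - {z} = (X - {z}) \<union> Y" using that X Y disjoint by blast
    then show ?thesis using rk[of "X - {z}" Y] by simp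
  qed
  moreover have "rk (principal_sum M N A B) (X \<union> Y - {z}) = f X (Y - {z})" if "z \<in> Y" for z
  proof -
    have "X \<union> Y - {z} = X \<union> (Y - {z})" using that X Y disjoint by blast
    then show ?thesis using rk[of X "Y - {z}"] by simp
  qed
  moreover have "X \<union> Y \<subseteq> ground (principal_sum M N A B)" using X Y ground_principal_sum by blast
  ultimately show ?thesis
    using rk[of X Y] by (auto simp: cyclic_iff_rk[OF matroid_principal_sum])
qed

end

section \<open>Comparison of the two terms of the rank formula\<close>

theorem theorem3p16:
  fixes M N :: "'a independence_system" and S T A B X Y :: "'a set"
  assumes "matroid M" and "ground M = S"
    and "matroid N" and "ground N = T"
    and "S \<inter> T = {}"
    and "A \<subseteq> S" and "B \<subseteq> T"
    and "X \<subseteq> S" and "Y \<subseteq> T"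
  shows "cyclic (principal_sum M N A B) (X \<union> Y) \<longleftrightarrow>
    (cyclic M X \<and> cyclic N Y \<and> Y \<inter> B = {}) \<or>
    ((\<forall>e. coloop (restriction M (X \<union> A)) e \<longrightarrow> e \<in> A) \<and> cyclic N Y \<and>
      rk M (X \<union> A) + rk N Y < rk M X + rk N (Y - B) + card (Y \<inter> B))"
proof -
  note M = assms(1) and N = assms(3)
  define a where "a = (\<lambda>X Y. rk M (X \<union> A) + rk N Y)"
  define b where "b = (\<lambda>X Y. rk M X + rk N (Y - B) + card (Y \<inter> B))"
  have "finite T" using N assms(4) unfolding matroid_def by blast
  then have fY: "finite Y" using assms(9) finite_subset by blast
  have cyc: "cyclic (principal_sum M N A B) (X \<union> Y) \<longleftrightarrow>
      (\<forall>z\<in>X. min (a (X - {z}) Y) (b (X - {z}) Y) = min (a X Y) (b X Y)) \<and>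
      (\<forall>z\<in>Y. min (a X (Y - {z})) (b X (Y - {z})) = min (a X Y) (b X Y))"
    unfolding a_def b_def using assms by (intro cyclic_principal_sum_iff_rk) auto
  have cycM: "cyclic M X \<longleftrightarrow> (\<forall>z\<in>X. rk M (X - {z}) = rk M X)"
    and cycN: "cyclic N Y \<longleftrightarrow> (\<forall>z\<in>Y. rk N (Y - {z}) = rk N Y)"
    using assms by (auto simp: cyclic_iff_rk)
  have MA: "rk M X' \<le> rk M (X' \<union> A)" for X' by (rule rk_mono[OF M]) blast
  \<comment> \<open>Positivity ensures that the truncated \<open>- 1\<close> is a genuine
    decrease.\<close>
  have cardB: "card ((Y - {z}) \<inter> B) = card (Y \<inter> B) - 1" "0 < card (Y \<inter> B)" if "z \<in> Y" "z \<in> B" for z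
  proof -
    have "(Y - {z}) \<inter> B = Y \<inter> B - {z}" by blast
    then show "card ((Y - {z}) \<inter> B) = card (Y \<inter> B) - 1" using that fY by simp
    show "0 < card (Y \<inter> B)" using that fY by (auto simp: card_gt_0_iff)
  qed
  have diffB: "Y - {z} - B = Y - B" if "z \<in> B" for z using that by blast
  have diffnB: "(Y - {z}) \<inter> B = Y \<inter> B" "Y - {z} - B = Y - B - {z}" if "z \<notin> B" for z
    using that by blast+
  show ?thesis
  proof (cases "a X Y < b X Y")
    case True
    have "b X Y \<le> Suc (b (X - {z}) Y)" for z
      unfolding b_def using rk_le_Suc_rk_diff[OF M, of X z] by simp
    \<comment> \<open>The strict gap absorbs a drop of one in \<open>b\<close>, so after the
      deletion \<open>b\<close> is still at least the old \<open>a\<close>. Hence the minimum is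
      preserved exactly when \<open>a\<close> is.\<close>
    then have bX: "a X Y \<le> b (X - {z}) Y" for z using True by (metis less_Suc_eq_le less_le_trans)
    have "b X Y \<le> Suc (b X (Y - {z}))" if "z \<in> Y" for z
    proof (cases "z \<in> B")
      case True
      then show ?thesis unfolding b_def using cardB[OF that True] diffB[OF True] by simp
    next
      case False
      then show ?thesis unfolding b_def
        using rk_le_Suc_rk_diff[OF N, of "Y - B" z] diffnB[OF False] by simp
    qed
    then have bY: "a X Y \<le> b X (Y - {z})" if "z \<in> Y" for z
      using True that by (metis less_Suc_eq_le less_le_trans)
    have "a (X - {z}) Y \<le> a X Y" for z
      unfolding a_def using rk_mono[OF M, of "X - {z} \<union> A" "X \<union> A"] by auto
    then have eX: "min (a (X - {z}) Y) (b (X - {z}) Y) = min (a X Y) (b X Y) \<longleftrightarrow>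
        a (X - {z}) Y = a X Y" for z
      using True bX[of z] by (smt (verit) min_def le_antisym less_imp_le order_trans)
    have "a X (Y - {z}) \<le> a X Y" for z
      unfolding a_def using rk_mono[OF N, of "Y - {z}" Y] by auto
    then have eY: "min (a X (Y - {z})) (b X (Y - {z})) = min (a X Y) (b X Y) \<longleftrightarrow>
        a X (Y - {z}) = a X Y" if "z \<in> Y" for z
      using True bY[OF that] by (smt (verit) min_def le_antisym less_imp_le order_trans)
    have "(\<forall>z\<in>X. a (X - {z}) Y = a X Y) \<longleftrightarrow>
        (\<forall>e. coloop (restriction M (X \<union> A)) e \<longrightarrow> e \<in> A)"
    proof -
      \<comment> \<open>Deleting an element of \<open>A\<close> from \<open>X\<close> leaves
        \<open>X \<union> A\<close> intact, so only elements outside \<open>A\<close> are tested for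
        being coloops.\<close>
      have eq: "(X - {z}) \<union> A = (if z \<in> A then X \<union> A else X \<union> A - {z})" for z by auto
      have "X \<union> A \<subseteq> ground M" using assms by blast
      then show ?thesis
        unfolding a_def eq by (auto simp: coloop_restriction_iff[OF M])
    qed
    moreover have "(\<forall>z\<in>Y. a X (Y - {z}) = a X Y) \<longleftrightarrow> cyclic N Y"
      unfolding cycN a_def by simp
    \<comment> \<open>This excludes alternative (1): with \<open>Y \<inter> B\<close> empty,
      \<open>b\<close> would be at most \<open>a\<close>.\<close>
    moreover have "Y \<inter> B \<noteq> {}"
    proof
      assume "Y \<inter> B = {}"
      moreover from this have "Y - B = Y" by blast
      ultimately show False using True MA[of X] unfolding a_def b_def by simp
    qed
    ultimately show ?thesis using cyc eX eY True unfolding a_def b_def by simp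
  next
    case False
    then have m: "min (a X Y) (b X Y) = b X Y" by simp
    \<comment> \<open>Alternative (2) is impossible here. Under (1), \<open>b\<close> is
      \<open>rk M X + rk N Y\<close>, which no deletion changes and which stays a lower bound for
      \<open>a\<close>.\<close>
    have "(\<forall>z\<in>X. b X Y \<le> a (X - {z}) Y \<and> b (X - {z}) Y = b X Y) \<and>
        (\<forall>z\<in>Y. b X Y \<le> a X (Y - {z}) \<and> b X (Y - {z}) = b X Y)"
      if h: "cyclic M X" "cyclic N Y" "Y \<inter> B = {}"
    proof -
      have eq: "Y - B = Y" "Y - {z} - B = Y - {z}" "(Y - {z}) \<inter> B = {}" for z using h by auto
      have X: "rk M (X - {z}) = rk M X" if "z \<in> X" for z using h cycM that by blast
      then have XA: "rk M X \<le> rk M (X - {z} \<union> A)" if "z \<in> X" for z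
        using MA[of "X - {z}"] that by simp
      have Y: "rk N (Y - {z}) = rk N Y" if "z \<in> Y" for z using h cycN that by blast
      show ?thesis
        unfolding a_def b_def eq h(3) using X XA Y MA[of X] by auto
    qed
    moreover have "cyclic M X \<and> cyclic N Y \<and> Y \<inter> B = {}"
      if h: "cyclic (principal_sum M N A B) (X \<union> Y)"
    proof -
      have bX: "b X Y \<le> b (X - {z}) Y" if "z \<in> X" for z using h that unfolding cyc m by (metis min.cobounded2)
      have bY: "b X Y \<le> b X (Y - {z})" if "z \<in> Y" for z using h that unfolding cyc m by (metis min.cobounded2)
      have YB: "Y \<inter> B = {}"
      proof (rule ccontr)
        assume "Y \<inter> B \<noteq> {}"
        then obtain z where z: "z \<in> Y" "z \<in> B" by blast
        \<comment> \<open>Deleting \<open>z\<close> from \<open>Y \<inter> B\<close> keeps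
          \<open>Y - B\<close> and removes one from the cardinality, so \<open>b\<close> would fall
          below the rank.\<close>
        then show False using bY[OF z(1)] cardB[OF z] diffB[OF z(2)] unfolding b_def by simp
      qed
      have eq: "Y - B = Y" "Y - {z} - B = Y - {z}" "(Y - {z}) \<inter> B = {}" for z using YB by auto
      have "rk M (X - {z}) = rk M X" if "z \<in> X" for z
        using bX[OF that] rk_mono[OF M, of "X - {z}" X] unfolding b_def by auto
      moreover have "rk N (Y - {z}) = rk N Y" if "z \<in> Y" for z
        using bY[OF that] rk_mono[OF N, of "Y - {z}" Y] unfolding b_def eq YB by auto
      ultimately show ?thesis using YB cycM cycN by blast
    qed
    ultimately have "cyclic (principal_sum M N A B) (X \<union> Y) \<longleftrightarrow>
        cyclic M X \<and> cyclic N Y \<and> Y \<inter> B = {}"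
      unfolding cyc m by (metis min.absorb2)
    then show ?thesis using False unfolding a_def b_def by blast
  qed
qed

end
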